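(* Let $V$ and $W$ be Banach spaces, and assume that the tensor powers of $V$ are all equipped with admissible norms. Assume that $\Sigma \subset V$ is closed. Let $\varepsilon > 0$, $(K_1,K_2) \in (\mathbb{R}_{\geq 0} \times \mathbb{R}_{\geq 0}) \setminus \{(0,0)\}$, $\gamma > 0$ with $k \in \mathbb{Z}_{\geq 0}$ such that $\gamma \in (k,k+1]$, and $0 \leq \varepsilon_0 < \min\{K_1+K_2,\varepsilon\}$. Then given any $l \in \{0,\ldots,k\}$, the constant $\delta_0 = \delta_0(\varepsilon,\varepsilon_0,K_1+K_2,\gamma,l)$ defined by $$\delta_0 := \sup\left\{ \theta > 0 : (K_1+K_2)\theta^{\gamma-l} + \varepsilon_0 e^{\theta} \leq \min\{K_1+K_2,\varepsilon\} \right\}$$ satisfies $\delta_0 > 0$ and the following is true. Suppose $B \subset \Sigma$ is a $\delta_0$-cover of $\Sigma$ in the sense that $$\Sigma \subset \bigcup_{x \in B} \overline{\mathbb{B}}_V(x,\delta_0) = \{ v \in V : \text{there exists } z \in B \text{ such that } \|v-z\|_V \leq \delta_0 \}.$$ Suppose $\psi = (\psi^{(0)},\ldots,\psi^{(k)})$ and $\varphi = (\varphi^{(0)},\ldots,\varphi^{(k)})$ in $\mathrm{Lip}(\gamma,\Sigma,W)$ satisfy $\|\psi\|_{\mathrm{Lip}(\gamma,\Sigma,W)} \leq K_1$ and $\|\varphi\|_{\mathrm{Lip}(\gamma,\Sigma,W)} \leq K_2$. Further suppose that for every $j \in \{0,\ldots,k\}$ and every $x \in B$ we have $$\left\| \psi^{(j)}(x)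 - \varphi^{(j)}(x) \right\|_{\mathcal{L}(V^{\otimes j};W)} \leq \varepsilon_0.$$ Then for every $s \in \{0,\ldots,l\}$ and every $x \in \Sigma$ we have $$\left\| \psi^{(s)}(x) - \varphi^{(s)}(x) \right\|_{\mathcal{L}(V^{\otimes s};W)} \leq \varepsilon.$$
   Context: All Banach spaces are real. $\overline{\mathbb{B}}_V(x,r) := \{v \in V : \|v-x\|_V \leq r\}$. Admissible norms: the tensor powers of $V$ are equipped with admissible norms if for each $n \in \mathbb{Z}_{\geq 2}$ the tensor power $V^{\otimes n}$ carries a norm $\|\cdot\|_{V^{\otimes n}}$ (with $V^{\otimes 1} = V$ carrying its own norm) such that: (i) for each $n \geq 1$ the symmetric group $S_n$ acts by isometries on $V^{\otimes n}$, the action being $\rho(a_1 \otimes \cdots \otimes a_n) := a_{\rho(1)} \otimes \cdots \otimes a_{\rho(n)}$ extended linearly; (ii) for all $n,m \geq 1$, $v \in V^{\otimes n}$, $w \in V^{\otimes m}$: $\|v \otimes w\|_{V^{\otimes(n+m)}} \leq \|v\|_{V^{\otimes n}} \|w\|_{V^{\otimes m}}$; (iii) for all $n,m \geq 1$, $\phi \in (V^{\otimes n})^*$, $\sigma \in (V^{\otimes m})^*$: $\|\phi \otimes \sigma\|_{(V^{\otimes (n+m)})^*} \leq \|\phi\|_{(V^{\otimes n})^*} \|\sigma\|_{(V^{\otimes m})^*}$, with dual norms. (Having both (ii) and (iii) forces equality in both.) $\mathcal{L}(V^{\otimes l};W)$ is the space of symmetric $l$-linear forms from $V$ to $W$, regarded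 as a subspace of the linear maps $V^{\otimes l} \to W$, with the operator norm $\|\mathbf{A}\|_{\mathcal{L}(V^{\otimes l};W)} = \sup\{\|\mathbf{A}[v]\|_W : \|v\|_{V^{\otimes l}} = 1\}$. $V^{\otimes 0} := \mathbb{R}$ and $\mathcal{L}(V^{\otimes 0};W) = W$ with norm $\|\cdot\|_W$. $\mathrm{Lip}(\gamma,\Sigma,W)$: let $\Sigma \subset V$ be closed, $\gamma > 0$ and $k \in \mathbb{Z}_{\geq 0}$ with $\gamma \in (k,k+1]$. A collection $\psi = (\psi^{(0)},\ldots,\psi^{(k)})$ of functions $\psi^{(l)} : \Sigma \to \mathcal{L}(V^{\otimes l};W)$ is in $\mathrm{Lip}(\gamma,\Sigma,W)$ if there is $M \geq 0$ such that for all $l \in \{0,\ldots,k\}$ and $x,y \in \Sigma$: (a) $\|\psi^{(l)}(x)\|_{\mathcal{L}(V^{\otimes l};W)} \leq M$; (b) $\|R^\psi_l(x,y)\|_{\mathcal{L}(V^{\otimes l};W)} \leq M\|y-x\|_V^{\gamma-l}$, where for $v \in V^{\otimes l}$ $$R^\psi_l(x,y)[v] := \psi^{(l)}(y)[v] - \sum_{s=0}^{k-l} \frac{1}{s!} \psi^{(l+s)}(x)\left[v \otimes (y-x)^{\otimes s}\right].$$ The norm $\|\psi\|_{\mathrm{Lip}(\gamma,\Sigma,W)}$ is the smallest such $M$. *)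

theory Defs
  imports "HOL-Analysis.Analysis" "HOL-Analysis.Finite_Function_Topology"
    "HOL-Combinatorics.Permutations"
begin

section \<open>Algebraic tensor powers\<close>

text \<open>
  The tensor algebra of a real vector space: the free vector space on all finite words over the
  space, modulo the relations expressing linearity in each letter. The relations are homogeneous
  in the length of the words, so the words of length \<open>n\<close> span the \<open>n\<close>-th tensor power.
\<close>

inductive_set tensor_relations :: "('v::real_vector list \<Rightarrow>\<^sub>0 real) set" where
  add: "Poly_Mapping.single (us @ (x + y) # ws) 1
          - Poly_Mapping.single (us @ x # ws) 1 - Poly_Mapping.single (us @ y # ws) 1
        \<in> tensor_relations"
| scale: "Poly_Mapping.single (us @ (c *\<^sub>R x) # ws) 1
            - c *\<^sub>R Poly_Mapping.single (us @ x # ws) 1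
          \<in> tensor_relations"

definition tensor_eq :: "('v::real_vector list \<Rightarrow>\<^sub>0 real) \<Rightarrow> ('v list \<Rightarrow>\<^sub>0 real) \<Rightarrow> bool" where
  "tensor_eq p q \<longleftrightarrow> p - q \<in> span tensor_relations"

lemma equivp_tensor_eq: "equivp (tensor_eq :: ('v::real_vector list \<Rightarrow>\<^sub>0 real) \<Rightarrow> _)"
proof (rule equivpI)
  show "reflp (tensor_eq :: ('v list \<Rightarrow>\<^sub>0 real) \<Rightarrow> _)"
    by (simp add: reflp_def tensor_eq_def span_zero)
  show "symp (tensor_eq :: ('v list \<Rightarrow>\<^sub>0 real) \<Rightarrow> _)"
  proof (rule sympI)
    fix p q :: "'v list \<Rightarrow>\<^sub>0 real"
    assume "tensor_eq p q"
    then show "tensor_eq q p"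
      using span_neg[of "p - q" tensor_relations] by (simp add: tensor_eq_def)
  qed
  show "transp (tensor_eq :: ('v list \<Rightarrow>\<^sub>0 real) \<Rightarrow> _)"
  proof (rule transpI)
    fix p q r :: "'v list \<Rightarrow>\<^sub>0 real"
    assume "tensor_eq p q" "tensor_eq q r"
    then show "tensor_eq p r"
      using span_add[of "p - q" tensor_relations "q - r"] by (simp add: tensor_eq_def)
  qed
qed

quotient_type (overloaded) 'v tensor = "'v::real_vector list \<Rightarrow>\<^sub>0 real" / tensor_eq
  by (rule equivp_tensor_eq)

instantiation tensor :: (real_vector) real_vector
begin

lift_definition zero_tensor :: "'a tensor" is 0 .

lift_definition plus_tensor :: "'a tensor \<Rightarrow> 'a tensor \<Rightarrow> 'a tensor" is "(+)"
  unfolding tensor_eq_def by (drule (1) span_add) (simp add: algebra_simps)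

lift_definition uminus_tensor :: "'a tensor \<Rightarrow> 'a tensor" is uminus
  unfolding tensor_eq_def by (drule span_neg) simp

lift_definition minus_tensor :: "'a tensor \<Rightarrow> 'a tensor \<Rightarrow> 'a tensor" is "(-)"
  unfolding tensor_eq_def by (drule (1) span_diff) (simp add: algebra_simps)

lift_definition scaleR_tensor :: "real \<Rightarrow> 'a tensor \<Rightarrow> 'a tensor" is scaleR
  unfolding tensor_eq_def by (drule span_scale) (simp add: scaleR_right_diff_distrib)

instance
proof
  fix a b c :: "'a tensor" and r s :: real
  note refl = equivp_reflp[OF tensor_equivp]
  show "a + b + c = a + (b + c)"
    by transfer (simp add: add.assoc refl)
  show "a + b = b + a"
    by transfer (simp add: add.commute refl)
  show "0 + a = a"
    by transfer (simp add: refl)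
  show "- a + a = 0"
    by transfer (simp add: refl)
  show "a - b = a + - b"
    by transfer (simp add: refl)
  show "r *\<^sub>R (a + b) = r *\<^sub>R a + r *\<^sub>R b"
    by transfer (simp add: scaleR_add_right refl)
  show "(r + s) *\<^sub>R a = r *\<^sub>R a + s *\<^sub>R a"
    by transfer (simp add: scaleR_add_left refl)
  show "r *\<^sub>R s *\<^sub>R a = (r * s) *\<^sub>R a"
    by transfer (simp add: refl)
  show "1 *\<^sub>R a = a"
    by transfer (simp add: refl)
qed

end

text \<open>\<open>pure_tensor [a\<^sub>1, \<dots>, a\<^sub>n]\<close> is \<open>a\<^sub>1 \<otimes> \<dots> \<otimes> a\<^sub>n\<close>; \<open>pure_tensor []\<close> is the unit of the scalars.\<close>

lift_definition pure_tensor :: "'v::real_vector list \<Rightarrow> 'v tensor" is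
  "\<lambda>xs. Poly_Mapping.single xs 1" .

definition tensor_power :: "nat \<Rightarrow> 'v::real_vector tensor set" where
  "tensor_power n = span (pure_tensor ` {xs. length xs = n})"

definition multilinear :: "('v::real_vector list \<Rightarrow> 'w::real_vector) \<Rightarrow> bool" where
  "multilinear f \<longleftrightarrow> (\<forall>us ws. linear (\<lambda>x. f (us @ x # ws)))"

definition free_extend :: "('v list \<Rightarrow> 'w::real_vector) \<Rightarrow> ('v list \<Rightarrow>\<^sub>0 real) \<Rightarrow> 'w" where
  "free_extend f p = (\<Sum>xs\<in>Poly_Mapping.keys p. Poly_Mapping.lookup p xs *\<^sub>R f xs)"

text \<open>
  The linear map induced by a multilinear \<open>f\<close>; by \<open>tensor_lift_linear\<close> and \<open>tensor_lift_pure\<close>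
  below it does not depend on the representative chosen by \<open>rep_tensor\<close>.
\<close>

definition tensor_lift :: "('v::real_vector list \<Rightarrow> 'w::real_vector) \<Rightarrow> 'v tensor \<Rightarrow> 'w" where
  "tensor_lift f t = free_extend f (rep_tensor t)"

definition tensor_mult :: "'v::real_vector tensor \<Rightarrow> 'v tensor \<Rightarrow> 'v tensor"
  (infixl \<open>\<otimes>\<^sub>T\<close> 70) where
  "u \<otimes>\<^sub>T v = tensor_lift (\<lambda>xs. tensor_lift (\<lambda>ys. pure_tensor (xs @ ys)) v) u"

definition tensor_permute :: "nat \<Rightarrow> (nat \<Rightarrow> nat) \<Rightarrow> 'v::real_vector tensor \<Rightarrow> 'v tensor" where
  "tensor_permute n \<rho> =
     tensor_lift (\<lambda>xs. if length xs = n then pure_tensor (permute_list \<rho> xs) else 0)"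

text \<open>The functional \<open>\<phi> \<otimes> \<sigma>\<close> on the \<open>(n + m)\<close>-th tensor power.\<close>

definition functional_tensor ::
  "nat \<Rightarrow> nat \<Rightarrow> ('v::real_vector tensor \<Rightarrow> real) \<Rightarrow> ('v tensor \<Rightarrow> real) \<Rightarrow> 'v tensor \<Rightarrow> real" where
  "functional_tensor n m \<phi> \<sigma> =
     tensor_lift (\<lambda>xs. if length xs = n + m
       then \<phi> (pure_tensor (take n xs)) * \<sigma> (pure_tensor (drop n xs)) else 0)"

definition linear_on_power ::
  "nat \<Rightarrow> ('v::real_vector tensor \<Rightarrow> 'w::real_vector) \<Rightarrow> bool" where
  "linear_on_power n A \<longleftrightarrow>
     (\<forall>u\<in>tensor_power n. \<forall>v\<in>tensor_power n. A (u + v) = A u + A v) \<and>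
     (\<forall>c. \<forall>v\<in>tensor_power n. A (c *\<^sub>R v) = c *\<^sub>R A v)"


subsection \<open>Basic properties\<close>

lemma pure_tensor_in_power: "length xs = n \<Longrightarrow> pure_tensor xs \<in> tensor_power n"
  by (auto simp: tensor_power_def intro: span_base)

lemma pure_tensor_add:
  "pure_tensor (us @ (x + y) # ws) = pure_tensor (us @ x # ws) + pure_tensor (us @ y # ws)"
  by transfer (simp add: tensor_eq_def diff_diff_eq[symmetric] span_base tensor_relations.add)

lemma pure_tensor_scale:
  "pure_tensor (us @ (c *\<^sub>R x) # ws) = c *\<^sub>R pure_tensor (us @ x # ws)"
  by transfer (simp add: tensor_eq_def span_base tensor_relations.scale)

lemma multilinear_pure_tensor: "multilinear pure_tensor"
  unfolding multilinear_def
  by (intro allI linearI) (simp_all add: pure_tensor_add pure_tensor_scale)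

lemma free_extend_superset:
  assumes "finite F" "Poly_Mapping.keys p \<subseteq> F"
  shows "free_extend f p = (\<Sum>xs\<in>F. Poly_Mapping.lookup p xs *\<^sub>R f xs)"
  unfolding free_extend_def using assms
  by (intro sum.mono_neutral_left) (auto simp: in_keys_iff)

lemma lookup_scaleR [simp]:
  "Poly_Mapping.lookup (c *\<^sub>R p) i = c *\<^sub>R Poly_Mapping.lookup p i"
  by (simp add: scaleR_poly_mapping_def)

lemma linear_free_extend: "linear (free_extend f)"
proof (rule linearI)
  fix p q :: "'a list \<Rightarrow>\<^sub>0 real" and c :: real
  let ?F = "Poly_Mapping.keys p \<union> Poly_Mapping.keys q"
  have "Poly_Mapping.keys (p + q) \<subseteq> ?F"
    by (rule Poly_Mapping.keys_add)
  then show "free_extend f (p + q) = free_extend f p + free_extend f q"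
    by (simp add: free_extend_superset[of ?F] lookup_add scaleR_add_left sum.distrib)
  have "Poly_Mapping.keys (c *\<^sub>R p) \<subseteq> Poly_Mapping.keys p"
    by (auto simp: in_keys_iff)
  then show "free_extend f (c *\<^sub>R p) = c *\<^sub>R free_extend f p"
    by (simp add: free_extend_superset[of "Poly_Mapping.keys p"] scaleR_sum_right)
qed

lemma free_extend_single: "free_extend f (Poly_Mapping.single xs 1) = f xs"
  by (simp add: free_extend_def)

lemma free_extend_relations:
  assumes "multilinear f" "p \<in> span tensor_relations"
  shows "free_extend f p = 0"
  using assms(2)
proof (induction rule: span_induct_alt)
  case base
  show ?case by (simp add: linear_0[OF linear_free_extend])
next
  case (step c p q)
  have lin: "linear (\<lambda>x. f (us @ x # ws))" for us ws
    using assms(1) by (simp add: multilinear_def)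
  from step(1) have "free_extend f p = 0"
    by cases (simp_all add: linear_diff[OF linear_free_extend] linear_cmul[OF linear_free_extend]
        free_extend_single linear_add[OF lin] linear_cmul[OF lin])
  with step(2) show ?case
    by (simp add: linear_add[OF linear_free_extend] linear_cmul[OF linear_free_extend])
qed

lemma tensor_lift_abs:
  assumes "multilinear f"
  shows "tensor_lift f (abs_tensor p) = free_extend f p"
proof -
  have "tensor_eq (rep_tensor (abs_tensor p)) p"
    using Quotient_tensor by (simp add: Quotient3_rep_abs[OF Quotient3_tensor]
        equivp_reflp[OF tensor_equivp])
  then show ?thesis
    using free_extend_relations[OF assms] linear_diff[OF linear_free_extend, of f]
    by (fastforce simp: tensor_lift_def tensor_eq_def)
qed

lemma tensor_lift_pure:
  "multilinear f \<Longrightarrow> tensor_lift f (pure_tensor xs) = f xs"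
  by (simp add: pure_tensor.abs_eq tensor_lift_abs free_extend_single)

lemma tensor_lift_linear:
  assumes "multilinear f"
  shows "linear (tensor_lift f)"
proof (rule linearI)
  fix u v :: "'a tensor" and c :: real
  obtain p q where "u = abs_tensor p" "v = abs_tensor q"
    by (metis Quotient3_abs_rep[OF Quotient3_tensor])
  then show "tensor_lift f (u + v) = tensor_lift f u + tensor_lift f v"
    and "tensor_lift f (c *\<^sub>R u) = c *\<^sub>R tensor_lift f u"
    using assms by (simp_all add: plus_tensor.abs_eq scaleR_tensor.abs_eq tensor_lift_abs
        linear_add[OF linear_free_extend] linear_cmul[OF linear_free_extend])
qed

lemma multilinear_prefix: "multilinear (\<lambda>ys. pure_tensor (xs @ ys))"
  unfolding multilinear_def
  by (intro allI linearI)
    (simp_all add: pure_tensor_add[of "xs @ _", simplified]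
      pure_tensor_scale[of "xs @ _", simplified])

lemma abs_tensor_cases:
  obtains p where "t = abs_tensor p"
  by (metis Quotient3_abs_rep[OF Quotient3_tensor])

lemma multilinear_append: "multilinear (\<lambda>xs. tensor_lift (\<lambda>ys. pure_tensor (xs @ ys)) v)"
proof -
  obtain p where v: "v = abs_tensor p"
    by (rule abs_tensor_cases)
  show ?thesis
    unfolding multilinear_def v tensor_lift_abs[OF multilinear_prefix] free_extend_def
    by (intro allI linearI)
      (simp_all add: pure_tensor_add pure_tensor_scale scaleR_add_right sum.distrib
        scaleR_sum_right mult.commute)
qed

lemma tensor_mult_pure: "pure_tensor xs \<otimes>\<^sub>T pure_tensor ys = pure_tensor (xs @ ys)"
  unfolding tensor_mult_def tensor_lift_pure[OF multilinear_append]
  by (rule tensor_lift_pure[OF multilinear_prefix])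

lemma tensor_mult_linear_left: "linear (\<lambda>u. u \<otimes>\<^sub>T v)"
  unfolding tensor_mult_def by (rule tensor_lift_linear) (rule multilinear_append)

lemma tensor_mult_linear_right: "linear (\<lambda>v. u \<otimes>\<^sub>T v)"
proof -
  note lin = tensor_lift_linear[OF multilinear_prefix]
  show ?thesis
    unfolding tensor_mult_def tensor_lift_def[of _ u] free_extend_def
    by (intro linearI)
      (simp_all add: linear_add[OF lin] linear_cmul[OF lin] scaleR_add_right sum.distrib
        scaleR_sum_right mult.commute)
qed

lemma multilinear_permute:
  assumes "\<rho> permutes {..<n}"
  shows "multilinear (\<lambda>xs. if length xs = n then pure_tensor (permute_list \<rho> xs) else 0)"
  unfolding multilinear_def
proof (intro allI)
  fix us ws :: "'a list"
  show "linear (\<lambda>x. if length (us @ x # ws) = n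
          then pure_tensor (permute_list \<rho> (us @ x # ws)) else 0)"
  proof (cases "length us + length ws + 1 = n")
    case True
    define j where "j = inv \<rho> (length us)"
    have rj: "\<rho> j = length us"
      unfolding j_def by (rule permutes_inverses(1)[OF assms])
    have jn: "j < n"
      using rj True permutes_in_image[OF assms, of j] by simp
    define l where "l = permute_list \<rho> (us @ 0 # ws)"
    have "permute_list \<rho> (us @ x # ws) = take j l @ x # drop (Suc j) l" for x
    proof -
      have "permute_list \<rho> (us @ x # ws) = l[j := x]"
      proof (rule nth_equalityI)
        fix i assume "i < length (permute_list \<rho> (us @ x # ws))"
        then have i: "i < n" using True by simp
        have "i \<noteq> j \<Longrightarrow> \<rho> i \<noteq> length us"
          using rj permutes_inj[OF assms] by (metis injD)
        then show "permute_list \<rho> (us @ x # ws) ! i = l[j := x] ! i"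
          using i jn rj True
          by (cases "i = j") (auto simp: l_def permute_list_def nth_append nth_Cons' simp del: upt_Suc)
      qed (simp add: l_def)
      then show ?thesis
        using jn True by (simp add: l_def upd_conv_take_nth_drop)
    qed
    then show ?thesis
      using True multilinear_pure_tensor[unfolded multilinear_def, rule_format, of "take j l"]
      by simp
  next
    case False
    then have "(length (us @ x # ws) = n) = False" for x by simp
    then show ?thesis by (simp only: if_False linear_zero)
  qed
qed

lemma tensor_permute_pure:
  "\<rho> permutes {..<n} \<Longrightarrow> length xs = n \<Longrightarrow>
   tensor_permute n \<rho> (pure_tensor xs) = pure_tensor (permute_list \<rho> xs)"
  by (simp add: tensor_permute_def tensor_lift_pure multilinear_permute)

lemma tensor_permute_linear: "\<rho> permutes {..<n} \<Longrightarrow> linear (tensor_permute n \<rho>)"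
  unfolding tensor_permute_def by (intro tensor_lift_linear multilinear_permute)

lemma multilinear_functional_tensor:
  assumes "linear_on_power n \<phi>" "linear_on_power m \<sigma>"
  shows "multilinear (\<lambda>xs. if length xs = n + m
           then \<phi> (pure_tensor (take n xs)) * \<sigma> (pure_tensor (drop n xs)) else 0 :: real)"
  unfolding multilinear_def
proof (intro allI)
  fix us ws :: "'a list"
  have add: "\<phi> (u + v) = \<phi> u + \<phi> v" "\<phi> (c *\<^sub>R u) = c * \<phi> u"
    if "u \<in> tensor_power n" "v \<in> tensor_power n" for u v c
    using assms(1) that by (auto simp: linear_on_power_def)
  have add': "\<sigma> (u + v) = \<sigma> u + \<sigma> v" "\<sigma> (c *\<^sub>R u) = c * \<sigma> u"
    if "u \<in> tensor_power m" "v \<in> tensor_power m" for u v c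
    using assms(2) that by (auto simp: linear_on_power_def)
  let ?f = "\<lambda>xs. if length xs = n + m
           then \<phi> (pure_tensor (take n xs)) * \<sigma> (pure_tensor (drop n xs)) else 0 :: real"
  consider "length us + length ws + 1 \<noteq> n + m"
    | "length us + length ws + 1 = n + m" "length us < n"
    | "length us + length ws + 1 = n + m" "n \<le> length us"
    by linarith
  then show "linear (\<lambda>x. ?f (us @ x # ws))"
  proof cases
    case 1
    then have "(length (us @ x # ws) = n + m) = False" for x by simp
    then show ?thesis by (simp only: if_False linear_zero)
  next
    case 2
    then obtain j where j: "n - length us = Suc j" "j \<le> length ws"
      by (cases "n - length us") auto
    have mem: "pure_tensor (us @ x # take j ws) \<in> tensor_power n" for x
      using 2 j by (intro pure_tensor_in_power) simp
    show ?thesis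
      using 2 j by (intro linearI)
        (simp_all add: pure_tensor_add pure_tensor_scale add[OF mem mem] distrib_right)
  next
    case 3
    have mem: "pure_tensor (drop n us @ x # ws) \<in> tensor_power m" for x
      using 3 by (intro pure_tensor_in_power) simp
    show ?thesis
      using 3 by (intro linearI)
        (simp_all add: pure_tensor_add pure_tensor_scale add'[OF mem mem] distrib_left)
  qed
qed

lemma functional_tensor_pure:
  assumes "linear_on_power n \<phi>" "linear_on_power m \<sigma>" "length xs = n" "length ys = m"
  shows "functional_tensor n m \<phi> \<sigma> (pure_tensor xs \<otimes>\<^sub>T pure_tensor ys)
         = \<phi> (pure_tensor xs) * \<sigma> (pure_tensor ys)"
  using assms
  by (simp add: tensor_mult_pure functional_tensor_def tensor_lift_pure
      multilinear_functional_tensor)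

lemma functional_tensor_linear:
  "linear_on_power n \<phi> \<Longrightarrow> linear_on_power m \<sigma> \<Longrightarrow> linear (functional_tensor n m \<phi> \<sigma>)"
  unfolding functional_tensor_def by (intro tensor_lift_linear multilinear_functional_tensor)


section \<open>Operator norms and admissible norms\<close>

text \<open>
  The supremum is taken in the extended nonnegative reals: it is \<open>\<infinity>\<close> for unbounded maps, and \<open>0\<close>
  when the unit sphere is empty, i.e. when the underlying space is trivial.
\<close>

definition op_norm ::
  "(nat \<Rightarrow> 'v::real_vector tensor \<Rightarrow> real) \<Rightarrow> nat \<Rightarrow> ('v tensor \<Rightarrow> 'w::real_normed_vector) \<Rightarrow> ennreal"
  where
  "op_norm N n A = (SUP v\<in>{v\<in>tensor_power n. N n v = 1}. ennreal (norm (A v)))"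

definition bounded_linear_on_power ::
  "(nat \<Rightarrow> 'v::real_vector tensor \<Rightarrow> real) \<Rightarrow> nat \<Rightarrow> ('v tensor \<Rightarrow> 'w::real_normed_vector) \<Rightarrow> bool"
  where
  "bounded_linear_on_power N n A \<longleftrightarrow> linear_on_power n A \<and> op_norm N n A < \<infinity>"

definition norm_on_power :: "nat \<Rightarrow> ('v::real_vector tensor \<Rightarrow> real) \<Rightarrow> bool" where
  "norm_on_power n \<nu> \<longleftrightarrow>
     (\<forall>v\<in>tensor_power n. 0 \<le> \<nu> v \<and> (\<nu> v = 0 \<longleftrightarrow> v = 0)) \<and>
     (\<forall>c. \<forall>v\<in>tensor_power n. \<nu> (c *\<^sub>R v) = \<bar>c\<bar> * \<nu> v) \<and>
     (\<forall>u\<in>tensor_power n. \<forall>v\<in>tensor_power n. \<nu> (u + v) \<le> \<nu> u + \<nu> v)"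

definition admissible_norms ::
  "(nat \<Rightarrow> 'v::real_normed_vector tensor \<Rightarrow> real) \<Rightarrow> bool" where
  "admissible_norms N \<longleftrightarrow>
     (\<forall>c. N 0 (c *\<^sub>R pure_tensor []) = \<bar>c\<bar>) \<and>
     (\<forall>x. N 1 (pure_tensor [x]) = norm x) \<and>
     (\<forall>n\<ge>2. norm_on_power n (N n)) \<and>
     (\<forall>n\<ge>1. \<forall>\<rho>. \<rho> permutes {..<n} \<longrightarrow>
        (\<forall>v\<in>tensor_power n. N n (tensor_permute n \<rho> v) = N n v)) \<and>
     (\<forall>n\<ge>1. \<forall>m\<ge>1. \<forall>v\<in>tensor_power n. \<forall>w\<in>tensor_power m.
        N (n + m) (v \<otimes>\<^sub>T w) \<le> N n v * N m w) \<and>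
     (\<forall>n\<ge>1. \<forall>m\<ge>1. \<forall>\<phi> \<sigma> :: 'v tensor \<Rightarrow> real.
        bounded_linear_on_power N n \<phi> \<longrightarrow> bounded_linear_on_power N m \<sigma> \<longrightarrow>
        op_norm N (n + m) (functional_tensor n m \<phi> \<sigma>) \<le> op_norm N n \<phi> * op_norm N m \<sigma>)"


section \<open>Lipschitz functions in the sense of Stein\<close>

text \<open>
  For \<open>l = 0\<close> these are the linear maps from the scalars to \<open>'w\<close>; evaluation at \<open>pure_tensor []\<close>
  identifies them isometrically with \<open>'w\<close>.
\<close>

definition symmetric_forms ::
  "(nat \<Rightarrow> 'v::real_vector tensor \<Rightarrow> real) \<Rightarrow> nat \<Rightarrow> ('v tensor \<Rightarrow> 'w::real_normed_vector) set"
  where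
  "symmetric_forms N l = {A. bounded_linear_on_power N l A \<and>
     (\<forall>\<rho> xs. \<rho> permutes {..<l} \<longrightarrow> length xs = l \<longrightarrow>
        A (pure_tensor (permute_list \<rho> xs)) = A (pure_tensor xs))}"

definition lip_remainder ::
  "nat \<Rightarrow> (nat \<Rightarrow> 'v \<Rightarrow> 'v::real_vector tensor \<Rightarrow> 'w::real_vector) \<Rightarrow>
   nat \<Rightarrow> 'v \<Rightarrow> 'v \<Rightarrow> 'v tensor \<Rightarrow> 'w" where
  "lip_remainder k \<psi> l x y v =
     \<psi> l y v - (\<Sum>s\<le>k - l. (1 / fact s) *\<^sub>R \<psi> (l + s) x (v \<otimes>\<^sub>T pure_tensor (replicate s (y - x))))"

definition lip_bound ::
  "(nat \<Rightarrow> 'v::real_normed_vector tensor \<Rightarrow> real) \<Rightarrow> real \<Rightarrow> nat \<Rightarrow> 'v set \<Rightarrow>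
   (nat \<Rightarrow> 'v \<Rightarrow> 'v tensor \<Rightarrow> 'w::real_normed_vector) \<Rightarrow> real \<Rightarrow> bool" where
  "lip_bound N \<gamma> k S \<psi> M \<longleftrightarrow>
     (\<forall>l\<le>k. \<forall>x\<in>S. \<forall>y\<in>S.
        op_norm N l (\<psi> l x) \<le> ennreal M \<and>
        op_norm N l (lip_remainder k \<psi> l x y) \<le> ennreal (M * norm (y - x) powr (\<gamma> - real l)))"

text \<open>Here \<open>k\<close> is the natural number with \<open>k < \<gamma> \<le> k + 1\<close>.\<close>

definition lip_space ::
  "(nat \<Rightarrow> 'v::real_normed_vector tensor \<Rightarrow> real) \<Rightarrow> real \<Rightarrow> nat \<Rightarrow> 'v set \<Rightarrow>
   (nat \<Rightarrow> 'v \<Rightarrow> 'v tensor \<Rightarrow> 'w::real_normed_vector) set" where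
  "lip_space N \<gamma> k S = {\<psi>. (\<forall>l\<le>k. \<forall>x\<in>S. \<psi> l x \<in> symmetric_forms N l) \<and>
                            (\<exists>M\<ge>0. lip_bound N \<gamma> k S \<psi> M)}"

text \<open>On \<open>lip_space\<close> the infimum is attained, since both bounds are closed conditions on \<open>M\<close>.\<close>

definition lip_norm ::
  "(nat \<Rightarrow> 'v::real_normed_vector tensor \<Rightarrow> real) \<Rightarrow> real \<Rightarrow> nat \<Rightarrow> 'v set \<Rightarrow>
   (nat \<Rightarrow> 'v \<Rightarrow> 'v tensor \<Rightarrow> 'w::real_normed_vector) \<Rightarrow> real" where
  "lip_norm N \<gamma> k S \<psi> = Inf {M. 0 \<le> M \<and> lip_bound N \<gamma> k S \<psi> M}"

definition cover_radius :: "real \<Rightarrow> real \<Rightarrow> real \<Rightarrow> real \<Rightarrow> nat \<Rightarrow> real" where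
  "cover_radius \<epsilon> \<epsilon>\<^sub>0 K \<gamma> l =
     Sup {\<theta>. 0 < \<theta> \<and> K * \<theta> powr (\<gamma> - real l) + \<epsilon>\<^sub>0 * exp \<theta> \<le> min K \<epsilon>}"

end

theory Submission
  imports Defs
begin

text \<open>
  Given \<open>x \<in> \<Sigma>\<close>, pick a point \<open>z\<close> of the cover within distance \<open>\<delta>\<^sub>0\<close> of \<open>x\<close> and expand
  \<open>\<psi>\<^sup>(\<^sup>s\<^sup>)(x) - \<phi>\<^sup>(\<^sup>s\<^sup>)(x)\<close> around \<open>z\<close>. The two remainders contribute at most
  \<open>(K\<^sub>1 + K\<^sub>2) \<delta>\<^sub>0\<^sup>\<gamma>\<^sup>-\<^sup>s\<close> and the Taylor terms at most \<open>\<epsilon>\<^sub>0 \<Sum>\<^sub>j \<delta>\<^sub>0\<^sup>j / j! \<le> \<epsilon>\<^sub>0 e\<^bsup>\<delta>\<^sub>0\<^esup>\<close>.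
  The defining inequality of \<open>\<delta>\<^sub>0\<close> forces \<open>\<delta>\<^sub>0 \<le> 1\<close>, so the exponent \<open>\<gamma> - s\<close> may be lowered to
  \<open>\<gamma> - l\<close>; by continuity that inequality also holds at \<open>\<delta>\<^sub>0\<close> itself.
\<close>

section \<open>Tensor powers and products in low degree\<close>

text \<open>Places the arguments of the Taylor terms in the tensor power on which the operator norm
  controls the form. By linearity in the left factor, pure tensors suffice.\<close>

lemma tensor_mult_pure_in_power:
  assumes "v \<in> tensor_power n" "length ys = m"
  shows "v \<otimes>\<^sub>T pure_tensor ys \<in> tensor_power (n + m)"
  using assms(1) unfolding tensor_power_def[of n]
proof (induction rule: span_induct_alt)
  case base
  show ?case
    by (simp add: linear_0[OF tensor_mult_linear_left] tensor_power_def span_zero)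
next
  case (step c u w)
  then obtain xs where "u = pure_tensor xs" "length xs = n" by auto
  then have "u \<otimes>\<^sub>T pure_tensor ys \<in> tensor_power (n + m)"
    using assms(2) by (simp add: tensor_mult_pure pure_tensor_in_power)
  with step show ?case
    unfolding tensor_power_def
    by (simp add: linear_add[OF tensor_mult_linear_left] linear_cmul[OF tensor_mult_linear_left]
        span_add span_scale)
qed

lemma tensor_power_0: "v \<in> tensor_power 0 \<Longrightarrow> \<exists>c. v = c *\<^sub>R pure_tensor []"
  by (auto simp: tensor_power_def span_singleton)

lemma linear_pure_singleton: "linear (\<lambda>x. pure_tensor [x])"
  using multilinear_pure_tensor[unfolded multilinear_def, rule_format, of "[]" "[]"] by simp

text \<open>The map sending \<open>x\<close> to \<open>pure_tensor [x]\<close> is linear, so its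
  range is already a subspace and taking the span adds nothing.\<close>

lemma tensor_power_1: "v \<in> tensor_power 1 \<Longrightarrow> \<exists>x. v = pure_tensor [x]"
proof -
  assume "v \<in> tensor_power 1"
  moreover have "pure_tensor ` {xs. length xs = 1} = range (\<lambda>x::'a. pure_tensor [x])"
    by (auto simp: length_Suc_conv image_iff)
  moreover have "span (range (\<lambda>x::'a. pure_tensor [x])) = range (\<lambda>x. pure_tensor [x])"
    unfolding span_eq_iff
    by (intro linear_subspace_image linear_pure_singleton subspace_UNIV)
  ultimately have "v \<in> range (\<lambda>x. pure_tensor [x])"
    by (simp only: tensor_power_def)
  then show ?thesis by (simp add: image_iff)
qed

section \<open>Estimates from admissibility\<close>

text \<open>Admissibility postulates the norm axioms only from degree 2 on. In degrees 0 and 1 it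
  prescribes values, and every element is a multiple of the unit or a single letter, so the axioms
  come from the absolute value and from \<open>norm\<close>.\<close>

lemma admissible_norm_on_power:
  assumes "admissible_norms N"
  shows "norm_on_power n (N n)"
proof -
  note lin = linear_pure_singleton
  consider "n = 0" | "n = 1" | "n \<ge> 2" by linarith
  then show ?thesis
  proof cases
    case 1
    have N: "N 0 (c *\<^sub>R pure_tensor []) = \<bar>c\<bar>" for c
      using assms by (simp add: admissible_norms_def)
    \<comment> \<open>The prescribed values separate the unit from zero: \<open>N 0\<close> is 1 at
      the former and 0 at the latter.\<close>
    have nz: "pure_tensor [] \<noteq> (0 :: 'a tensor)"
      using N[of 0] N[of 1] by auto
    show ?thesis
      unfolding 1 norm_on_power_def
      using N[of 0]
      by (auto dest!: tensor_power_0 simp: N nz abs_mult scaleR_add_left[symmetric])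
  next
    case 2
    have N: "N (Suc 0) (pure_tensor [x]) = norm x" for x
      using assms by (simp add: admissible_norms_def)
    have nz: "pure_tensor [x] = 0 \<longleftrightarrow> x = 0" for x :: 'a
      using N[of x] N[of 0] linear_0[OF lin] by (metis norm_eq_zero)
    show ?thesis
      unfolding 2 norm_on_power_def
      by (auto dest!: tensor_power_1[unfolded One_nat_def] simp: N nz norm_triangle_ineq
          linear_add[OF lin, symmetric] linear_cmul[OF lin, symmetric])
  next
    case 3
    with assms show ?thesis by (simp add: admissible_norms_def)
  qed
qed

lemma admissible_tensor_mult:
  assumes "admissible_norms N" "n \<ge> 1" "m \<ge> 1" "v \<in> tensor_power n" "w \<in> tensor_power m"
  shows "N (n + m) (v \<otimes>\<^sub>T w) \<le> N n v * N m w"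
  using assms unfolding admissible_norms_def by blast

lemma admissible_pure_replicate:
  assumes "admissible_norms N"
  shows "N j (pure_tensor (replicate j h)) \<le> norm h ^ j"
proof (induction j)
  case 0
  have "N 0 (1 *\<^sub>R pure_tensor []) = \<bar>1\<bar>"
    using assms unfolding admissible_norms_def by blast
  then show ?case by simp
next
  case (Suc j)
  have N1: "N (Suc 0) (pure_tensor [h]) = norm h"
    using assms by (simp add: admissible_norms_def)
  show ?case
  \<comment> \<open>Submultiplicativity is available only for positive degrees, so the first letter
    can be split off only when letters remain.\<close>
  proof (cases "j = 0")
    case False
    have "N (1 + j) (pure_tensor [h] \<otimes>\<^sub>T pure_tensor (replicate j h))
        \<le> N 1 (pure_tensor [h]) * N j (pure_tensor (replicate j h))"
      using False by (intro admissible_tensor_mult[OF assms] pure_tensor_in_power) auto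
    also have "\<dots> \<le> norm h * norm h ^ j"
      using Suc by (simp add: N1 mult_left_mono)
    finally show ?thesis by (simp add: tensor_mult_pure)
  qed (simp add: N1)
qed

text \<open>For positive degrees this is submultiplicativity. If \<open>n = 0\<close>, the left
  factor is a scalar and homogeneity of \<open>N j\<close> replaces it; if \<open>j = 0\<close>, the
  right factor is the unit.\<close>

lemma admissible_mult_replicate:
  assumes "admissible_norms N" "v \<in> tensor_power n"
  shows "N (n + j) (v \<otimes>\<^sub>T pure_tensor (replicate j h)) \<le> N n v * norm h ^ j"
proof -
  have norm: "norm_on_power m (N m)" for m
    by (rule admissible_norm_on_power[OF assms(1)])
  have pow: "pure_tensor (replicate j h) \<in> tensor_power j"
    by (simp add: pure_tensor_in_power)
  have nonneg: "0 \<le> N n v"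
    using norm assms(2) by (simp add: norm_on_power_def)
  have pure: "N n v * N j (pure_tensor (replicate j h)) \<le> N n v * norm h ^ j"
    by (intro mult_left_mono admissible_pure_replicate assms(1) nonneg)
  consider "n = 0" | "j = 0" | "n \<ge> 1" "j \<ge> 1" by linarith
  then show ?thesis
  proof cases
    case 1
    then obtain c where v: "v = c *\<^sub>R pure_tensor []"
      using assms(2) tensor_power_0 by blast
    have "N 0 v = \<bar>c\<bar>"
      using assms(1) by (simp add: admissible_norms_def v)
    moreover have "N j (c *\<^sub>R pure_tensor (replicate j h))
        = \<bar>c\<bar> * N j (pure_tensor (replicate j h))"
      using norm[of j] pow by (simp add: norm_on_power_def)
    ultimately show ?thesis
      using pure by (simp add: 1 v linear_cmul[OF tensor_mult_linear_left] tensor_mult_pure)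
  next
    case 2
    have "v \<otimes>\<^sub>T pure_tensor [] = v"
      by (rule linear_eq_on[OF tensor_mult_linear_left linear_ident
            assms(2)[unfolded tensor_power_def]])
        (auto simp: tensor_mult_pure)
    then show ?thesis by (simp add: 2)
  next
    case 3
    then show ?thesis
      using admissible_tensor_mult[OF assms(1) _ _ assms(2) pow] pure by force
  qed
qed

section \<open>Operator norms and Lipschitz bounds\<close>

lemma op_norm_le_iff:
  assumes "0 \<le> c"
  shows "op_norm N n A \<le> ennreal c \<longleftrightarrow>
    (\<forall>v\<in>tensor_power n. N n v = 1 \<longrightarrow> norm (A v) \<le> c)"
  using assms by (auto simp: op_norm_def SUP_le_iff)

text \<open>Rescaling \<open>w\<close> to the unit sphere reduces the claim to the supremum. Zero
  cannot be rescaled and is handled by homogeneity.\<close>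

lemma op_norm_bound:
  assumes "norm_on_power n (N n)" "linear_on_power n A" "0 \<le> c"
    and "op_norm N n A \<le> ennreal c" "w \<in> tensor_power n"
  shows "norm (A w) \<le> c * N n w"
proof (cases "w = 0")
  case True
  have "A (0 *\<^sub>R w) = 0 *\<^sub>R A w"
    using assms(2,5) unfolding linear_on_power_def by blast
  then show ?thesis
    using assms(1,5) True by (auto simp: norm_on_power_def)
next
  case False
  define r where "r = N n w"
  have r: "r > 0"
    using assms(1,5) False by (auto simp: norm_on_power_def r_def less_le)
  have mem: "(1 / r) *\<^sub>R w \<in> tensor_power n"
    using assms(5) by (simp add: tensor_power_def span_scale)
  have "N n ((1 / r) *\<^sub>R w) = \<bar>1 / r\<bar> * N n w"
    using assms(1,5) unfolding norm_on_power_def by blast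
  then have "N n ((1 / r) *\<^sub>R w) = 1"
    using r by (simp flip: r_def)
  then have "norm (A ((1 / r) *\<^sub>R w)) \<le> c"
    using assms(3,4) mem by (simp add: op_norm_le_iff)
  moreover have "A ((1 / r) *\<^sub>R w) = (1 / r) *\<^sub>R A w"
    using assms(2,5) unfolding linear_on_power_def by blast
  ultimately show ?thesis
    using r by (simp add: field_simps flip: r_def)
qed

lemma lip_bound_iff:
  assumes "0 \<le> M"
  shows "lip_bound N \<gamma> k S \<psi> M \<longleftrightarrow>
    (\<forall>l\<le>k. \<forall>x\<in>S. \<forall>y\<in>S. \<forall>v\<in>tensor_power l. N l v = 1 \<longrightarrow>
       norm (\<psi> l x v) \<le> M \<and>
       norm (lip_remainder k \<psi> l x y v) \<le> M * norm (y - x) powr (\<gamma> - real l))"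
  using assms unfolding lip_bound_def by (simp add: op_norm_le_iff) blast

text \<open>At each fixed unit tensor, both conditions are nonstrict inequalities affine in the
  constant, so they pass to the infimum and then to any larger \<open>K\<close>.\<close>

lemma lip_bound_norm_le:
  assumes "\<psi> \<in> lip_space N \<gamma> k S" "lip_norm N \<gamma> k S \<psi> \<le> K"
  shows "lip_bound N \<gamma> k S \<psi> K"
proof -
  let ?A = "{M. 0 \<le> M \<and> lip_bound N \<gamma> k S \<psi> M}"
  have ne: "?A \<noteq> {}"
    using assms(1) by (auto simp: lip_space_def)
  have Inf: "c \<le> K" if "\<And>M. M \<in> ?A \<Longrightarrow> c \<le> M" for c
    using cInf_greatest[OF ne that] assms(2) by (simp add: lip_norm_def)
  have K: "0 \<le> K"
    by (rule Inf) simp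
  have "norm (\<psi> l x v) \<le> K"
    "norm (lip_remainder k \<psi> l x y v) \<le> K * norm (y - x) powr (\<gamma> - real l)"
    if "l \<le> k" "x \<in> S" "y \<in> S" "v \<in> tensor_power l" "N l v = 1" for l x y v
  proof -
    let ?p = "norm (y - x) powr (\<gamma> - real l)"
    have M: "norm (\<psi> l x v) \<le> M \<and> norm (lip_remainder k \<psi> l x y v) \<le> M * ?p"
      if "M \<in> ?A" for M
      using that \<open>l \<le> k\<close> \<open>x \<in> S\<close> \<open>y \<in> S\<close> \<open>v \<in> tensor_power l\<close> \<open>N l v = 1\<close>
      by (auto simp: lip_bound_iff)
    show "norm (\<psi> l x v) \<le> K"
      using M by (intro Inf) blast
    show "norm (lip_remainder k \<psi> l x y v) \<le> K * ?p"
    \<comment> \<open>The power vanishes exactly when \<open>x = y\<close>. Division is then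
      impossible, but any admissible constant already forces the remainder to be 0.\<close>
    proof (cases "?p = 0")
      case True
      then show ?thesis using M ne by force
    next
      case False
      then have p: "?p > 0" by (simp add: less_le)
      then have "norm (lip_remainder k \<psi> l x y v) / ?p \<le> K"
        using M by (intro Inf) (simp add: divide_le_eq)
      with p show ?thesis by (simp add: divide_le_eq)
    qed
  qed
  with K show ?thesis by (simp add: lip_bound_iff)
qed

section \<open>The cover radius and the exponential bound\<close>

lemma cover_radius_properties:
  fixes \<epsilon> \<epsilon>\<^sub>0 K \<gamma> :: real
  assumes "K > 0" "0 \<le> \<epsilon>\<^sub>0" "\<epsilon>\<^sub>0 < min K \<epsilon>" "real l < \<gamma>"
  defines "\<delta> \<equiv> cover_radius \<epsilon> \<epsilon>\<^sub>0 K \<gamma> l"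
  shows "0 < \<delta>" "\<delta> \<le> 1" "K * \<delta> powr (\<gamma> - real l) + \<epsilon>\<^sub>0 * exp \<delta> \<le> min K \<epsilon>"
proof -
  define F where "F = (\<lambda>\<theta>. K * \<theta> powr (\<gamma> - real l) + \<epsilon>\<^sub>0 * exp \<theta>)"
  define T where "T = {\<theta>. 0 < \<theta> \<and> F \<theta> \<le> min K \<epsilon>}"
  have \<delta>: "\<delta> = Sup T"
    by (simp add: \<delta>_def cover_radius_def T_def F_def)
  have "(F \<longlongrightarrow> K * 0 powr (\<gamma> - real l) + \<epsilon>\<^sub>0 * exp 0) (at_right 0)"
    unfolding F_def using assms(4)
    by (intro tendsto_intros tendsto_powr') (auto simp: eventually_at_right_less eventually_at_filter)
  then have "(F \<longlongrightarrow> \<epsilon>\<^sub>0) (at_right 0)" by simp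
  then have "\<forall>\<^sub>F \<theta> in at_right 0. F \<theta> < min K \<epsilon>"
    using assms(3) by (rule order_tendstoD(2))
  then obtain b where b: "b > 0" "\<And>\<theta>. 0 < \<theta> \<Longrightarrow> \<theta> < b \<Longrightarrow> F \<theta> < min K \<epsilon>"
    by (auto simp: eventually_at_right_field)
  have T: "b / 2 \<in> T"
    using b(1) b(2)[of "b / 2"] by (simp add: T_def)
  have le1: "\<theta> \<le> 1" if "\<theta> \<in> T" for \<theta>
  proof (rule ccontr)
    assume "\<not> \<theta> \<le> 1"
    then have "1 < \<theta> powr (\<gamma> - real l)"
      using assms(4) by simp
    then have "K < F \<theta>"
      using mult_strict_left_mono[OF _ assms(1), of 1] mult_nonneg_nonneg[OF assms(2), of "exp \<theta>"]
      by (force simp: F_def)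
    with that show False by (simp add: T_def)
  qed
  then have bdd: "bdd_above T" by (auto simp: bdd_above_def)
  show pos: "0 < \<delta>"
    using cSup_upper[OF T bdd] b(1) by (simp add: \<delta>)
  show "\<delta> \<le> 1"
    unfolding \<delta> using T le1 by (intro cSup_least) auto
  have F\<delta>: "F \<delta> \<le> min K \<epsilon>"
  proof -
    \<comment> \<open>The supremum is a limit of members of \<open>T\<close>; positivity of \<delta>
      gives continuity of \<open>F\<close> there.\<close>
    have "\<delta> \<in> closure T"
      unfolding \<delta> using T bdd by (intro closure_contains_Sup) auto
    then obtain f where f: "\<And>n. f n \<in> T" "f \<longlonglongrightarrow> \<delta>"
      by (auto simp: closure_sequential)
    have "(\<lambda>n. F (f n)) \<longlonglongrightarrow> F \<delta>"
      unfolding F_def using pos by (intro tendsto_intros f(2)) auto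
    then show ?thesis
      using f(1) by (intro LIMSEQ_le_const2) (auto simp: T_def)
  qed
  then show "K * \<delta> powr (\<gamma> - real l) + \<epsilon>\<^sub>0 * exp \<delta> \<le> min K \<epsilon>"
    by (simp add: F_def)
qed

lemma sum_power_div_fact_le_exp:
  fixes x :: real
  assumes "0 \<le> x"
  shows "(\<Sum>j\<le>n. x ^ j / fact j) \<le> exp x"
proof -
  have "(\<lambda>j. x ^ j / fact j) sums exp x"
    using exp_converges[of x] by (simp add: divide_inverse mult.commute)
  then show ?thesis
    using assms by (intro sum_le_suminf[of _ "{..n}", THEN order_trans])
      (auto simp: sums_iff)
qed

section \<open>Taylor expansion around a cover point\<close>

theorem theorem3p11:
  fixes N :: "nat \<Rightarrow> 'v::banach tensor \<Rightarrow> real"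
    and S :: "'v set"
    and \<epsilon> \<epsilon>\<^sub>0 K\<^sub>1 K\<^sub>2 \<gamma> :: real
    and k l :: nat
  assumes "admissible_norms N"
    and "closed S"
    and "\<epsilon> > 0"
    and "K\<^sub>1 \<ge> 0" and "K\<^sub>2 \<ge> 0" and "(K\<^sub>1, K\<^sub>2) \<noteq> (0, 0)"
    and "\<gamma> > 0" and "real k < \<gamma>" and "\<gamma> \<le> real k + 1"
    and "0 \<le> \<epsilon>\<^sub>0" and "\<epsilon>\<^sub>0 < min (K\<^sub>1 + K\<^sub>2) \<epsilon>"
    and "l \<le> k"
  shows "cover_radius \<epsilon> \<epsilon>\<^sub>0 (K\<^sub>1 + K\<^sub>2) \<gamma> l > 0 \<and>
    (\<forall>B (\<psi> :: nat \<Rightarrow> 'v \<Rightarrow> 'v tensor \<Rightarrow> 'w::banach) \<phi>.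
       B \<subseteq> S \<longrightarrow>
       S \<subseteq> (\<Union>x\<in>B. cball x (cover_radius \<epsilon> \<epsilon>\<^sub>0 (K\<^sub>1 + K\<^sub>2) \<gamma> l)) \<longrightarrow>
       \<psi> \<in> lip_space N \<gamma> k S \<longrightarrow> \<phi> \<in> lip_space N \<gamma> k S \<longrightarrow>
       lip_norm N \<gamma> k S \<psi> \<le> K\<^sub>1 \<longrightarrow> lip_norm N \<gamma> k S \<phi> \<le> K\<^sub>2 \<longrightarrow>
       (\<forall>j\<le>k. \<forall>x\<in>B. op_norm N j (\<lambda>v. \<psi> j x v - \<phi> j x v) \<le> ennreal \<epsilon>\<^sub>0) \<longrightarrow>
       (\<forall>s\<le>l. \<forall>x\<in>S. op_norm N s (\<lambda>v. \<psi> s x v - \<phi> s x v) \<le> ennreal \<epsilon>))"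
proof -
  define K where "K = K\<^sub>1 + K\<^sub>2"
  define \<delta> where "\<delta> = cover_radius \<epsilon> \<epsilon>\<^sub>0 K \<gamma> l"
  have K: "K > 0"
    using assms(4-6) by (auto simp: K_def)
  have \<delta>: "0 < \<delta>" "\<delta> \<le> 1" "K * \<delta> powr (\<gamma> - real l) + \<epsilon>\<^sub>0 * exp \<delta> \<le> min K \<epsilon>"
    using cover_radius_properties[of K \<epsilon>\<^sub>0 \<epsilon> l \<gamma>] K assms by (auto simp: \<delta>_def K_def)
  note norm = admissible_norm_on_power[OF assms(1)]
  \<comment> \<open>The estimate is made at each tensor of the unit sphere, with real values;
    \<open>op_norm_le_iff\<close> converts it to the operator norm at the end.\<close>
  have main: "norm (\<psi> s x v - \<phi> s x v) \<le> \<epsilon>"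
    if B: "B \<subseteq> S" "S \<subseteq> (\<Union>x\<in>B. cball x \<delta>)"
      and lip: "\<psi> \<in> lip_space N \<gamma> k S" "\<phi> \<in> lip_space N \<gamma> k S"
        "lip_norm N \<gamma> k S \<psi> \<le> K\<^sub>1" "lip_norm N \<gamma> k S \<phi> \<le> K\<^sub>2"
      and close: "\<forall>j\<le>k. \<forall>x\<in>B. op_norm N j (\<lambda>v. \<psi> j x v - \<phi> j x v) \<le> ennreal \<epsilon>\<^sub>0"
      and s: "s \<le> l" and x: "x \<in> S" and v: "v \<in> tensor_power s" "N s v = 1"
    for B s x v and \<psi> \<phi> :: "nat \<Rightarrow> 'v \<Rightarrow> 'v tensor \<Rightarrow> 'w"
  proof -
    from B(2) x obtain z where z: "z \<in> B" "dist z x \<le> \<delta>" by auto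
    define h where "h = x - z"
    have h: "norm h \<le> \<delta>"
      using z(2) by (simp add: h_def dist_norm norm_minus_commute)
    have zS: "z \<in> S" using z B by auto
    have sk: "s \<le> k" using s assms(12) by simp
    have R\<psi>: "norm (lip_remainder k \<psi> s z x v) \<le> K\<^sub>1 * norm h powr (\<gamma> - real s)"
      using lip_bound_norm_le[OF lip(1,3)] assms(4) sk zS x v
      by (simp add: lip_bound_iff h_def)
    have R\<phi>: "norm (lip_remainder k \<phi> s z x v) \<le> K\<^sub>2 * norm h powr (\<gamma> - real s)"
      using lip_bound_norm_le[OF lip(2,4)] assms(5) sk zS x v
      by (simp add: lip_bound_iff h_def)
    define w where "w j = v \<otimes>\<^sub>T pure_tensor (replicate j h)" for j
    define D where "D j = \<psi> (s + j) z (w j) - \<phi> (s + j) z (w j)" for j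
    \<comment> \<open>Closeness at \<open>z\<close> is applied at order \<open>s + j\<close>, which
      may exceed \<open>l\<close> but not \<open>k\<close>. The tensor \<open>w j\<close> has norm
      at most \<open>norm h ^ j\<close> because \<open>N s v = 1\<close>.\<close>
    have D: "norm (D j) \<le> \<epsilon>\<^sub>0 * \<delta> ^ j" if "j \<le> k - s" for j
    proof -
      have sj: "s + j \<le> k" using that sk by simp
      have "linear_on_power (s + j) (\<psi> (s + j) z)" "linear_on_power (s + j) (\<phi> (s + j) z)"
        using lip(1,2) sj zS
        by (auto simp: lip_space_def symmetric_forms_def bounded_linear_on_power_def)
      then have "linear_on_power (s + j) (\<lambda>v. \<psi> (s + j) z v - \<phi> (s + j) z v)"
        by (simp add: linear_on_power_def scaleR_right_diff_distrib)
      then have "norm (D j) \<le> \<epsilon>\<^sub>0 * N (s + j) (w j)"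
        unfolding D_def w_def using close sj z(1) assms(10) v(1)
        by (intro op_norm_bound[OF norm] tensor_mult_pure_in_power) auto
      also have "N (s + j) (w j) \<le> norm h ^ j"
        using admissible_mult_replicate[OF assms(1) v(1)] v(2) by (simp add: w_def)
      also have "\<dots> \<le> \<delta> ^ j"
        using h by (simp add: power_mono)
      finally show ?thesis
        using assms(10) by (simp add: mult_left_mono)
    qed
    \<comment> \<open>Both remainders have base point \<open>z\<close> and are evaluated at
      \<open>x\<close>; subtracting their definitions combines the two Taylor sums into the terms
      \<open>D j\<close>.\<close>
    have "\<psi> s x v - \<phi> s x v = lip_remainder k \<psi> s z x v - lip_remainder k \<phi> s z x v
        + (\<Sum>j\<le>k - s. (1 / fact j) *\<^sub>R D j)"
      by (simp add: lip_remainder_def D_def w_def h_def scaleR_right_diff_distrib sum_subtractf)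
    also have "norm \<dots> \<le> norm (lip_remainder k \<psi> s z x v) + norm (lip_remainder k \<phi> s z x v)
        + norm (\<Sum>j\<le>k - s. (1 / fact j) *\<^sub>R D j)"
      by (meson add_mono_thms_linordered_semiring(3) norm_triangle_ineq norm_triangle_ineq4 order_trans)
    also have "\<dots> \<le> K * \<delta> powr (\<gamma> - real l) + \<epsilon>\<^sub>0 * exp \<delta>"
    proof (rule add_mono)
      \<comment> \<open>The exponent is positive because \<open>s \<le> k < \<gamma>\<close>, so the
        base may be enlarged to \<delta>. Only then, with \<open>\<delta> \<le> 1\<close>, is the
        exponent lowered.\<close>
      have "norm h powr (\<gamma> - real s) \<le> \<delta> powr (\<gamma> - real s)"
        using h sk assms(8) by (intro powr_mono2) auto
      also have "\<dots> \<le> \<delta> powr (\<gamma> - real l)"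
        using \<delta>(1,2) s by (intro powr_mono') auto
      finally have "K * norm h powr (\<gamma> - real s) \<le> K * \<delta> powr (\<gamma> - real l)"
        using K by simp
      then show "norm (lip_remainder k \<psi> s z x v) + norm (lip_remainder k \<phi> s z x v)
          \<le> K * \<delta> powr (\<gamma> - real l)"
        using R\<psi> R\<phi> by (simp add: K_def distrib_right)
      have "norm (\<Sum>j\<le>k - s. (1 / fact j) *\<^sub>R D j) \<le> (\<Sum>j\<le>k - s. \<epsilon>\<^sub>0 * (\<delta> ^ j / fact j))"
        using D by (intro sum_norm_le) (simp add: divide_right_mono)
      also have "\<dots> \<le> \<epsilon>\<^sub>0 * exp \<delta>"
        using sum_power_div_fact_le_exp[of \<delta> "k - s"] \<delta>(1) assms(10)
        by (subst sum_distrib_left[symmetric]) (auto intro: mult_left_mono)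
      finally show "norm (\<Sum>j\<le>k - s. (1 / fact j) *\<^sub>R D j) \<le> \<epsilon>\<^sub>0 * exp \<delta>" .
    qed
    finally show ?thesis using \<delta>(3) by simp
  qed
  show ?thesis
    unfolding K_def[symmetric] \<delta>_def[symmetric]
  proof (intro conjI allI impI ballI \<delta>(1))
    fix B s x and \<psi> \<phi> :: "nat \<Rightarrow> 'v \<Rightarrow> 'v tensor \<Rightarrow> 'w"
    assume "B \<subseteq> S" "S \<subseteq> (\<Union>x\<in>B. cball x \<delta>)" "\<psi> \<in> lip_space N \<gamma> k S" "\<phi> \<in> lip_space N \<gamma> k S"
      "lip_norm N \<gamma> k S \<psi> \<le> K\<^sub>1" "lip_norm N \<gamma> k S \<phi> \<le> K\<^sub>2"
      "\<forall>j\<le>k. \<forall>x\<in>B. op_norm N j (\<lambda>v. \<psi> j x v - \<phi> j x v) \<le> ennreal \<epsilon>\<^sub>0"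
      "s \<le> l" "x \<in> S"
    then show "op_norm N s (\<lambda>v. \<psi> s x v - \<phi> s x v) \<le> ennreal \<epsilon>"
      using main[of B \<psi> \<phi> s x] assms(3) by (simp add: op_norm_le_iff)
  qed
qed

end
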